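(* Let $\{(x^k,y^k)\}_{k\in\mathbb{N}_0}$ be a sequence of iterates generated by the difference-of-$\Phi$-convex algorithm ($\Phi$-DCA). Then $$\lim_{k\to\infty}\operatorname{gap}_g^\Phi(x^k,y^k)=0\quad\text{and}\quad\lim_{k\to\infty}\operatorname{gap}_f^\Phi(y^k,x^{k+1})=0.$$ Moreover, every limit point $(x^\star,y^\star)$ of the sequence of iterates with $(x^\star,y^\star)\in X\times Y$ satisfies $y^\star\in\partial_\Phi f(x^\star)\cap\partial_\Phi g(x^\star)$, i.e. $x^\star$ is a $\Phi$-critical point of $F$.
   Context: Setting. $X\subseteq\mathbb{R}^n$ and $Y\subseteq\mathbb{R}^m$ are nonempty and $\Phi:X\times Y\to\mathbb{R}$ is jointly continuous relative to $X\times Y$. $\overline{\mathbb{R}}=\mathbb{R}\cup\{\pm\infty\}$. A function is proper if it never takes the value $-\infty$ and is not identically $+\infty$. A function $f:X\to\overline{\mathbb{R}}$ is $\Phi$-convex if there are an index set $I$ and $(y_i,\beta_i)\in Y\times\overline{\mathbb{R}}$, $i\in I$, with $f(x)=\sup_{i\in I}\Phi(x,y_i)-\beta_i$ for all $x\in X$ (and $f\equiv-\infty$ if $I=\emptyset$). Standing assumptions: $f:X\to\overline{\mathbb{R}}$ is proper and $\Phi$-convex; $g:X\to\overline{\mathbb{R}}$ is proper and lower semicontinuous relative to $X$, and there exist $y\in Y$, $\beta\in\mathbb{R}$ with $g\ge\Phi(\cdot,y)-\beta$ on $X$; $F:=g-f$ (with the convention $g(x)-f(x)=+\infty$ if both values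 are $+\infty$) satisfies $-\infty<\inf_X F<\infty$. $\Phi$-conjugate: for $\varphi:X\to\overline{\mathbb{R}}$, $\varphi^\Phi(y)=\sup_{x\in X}\Phi(x,y)-\varphi(x)$. $\Phi$-subdifferential: $y\in\partial_\Phi\varphi(\bar x)$ iff $y\in Y$ and $\varphi(x)\ge\varphi(\bar x)+\Phi(x,y)-\Phi(\bar x,y)$ for all $x\in X$. Inverse: $(\partial_\Phi g)^{-1}(y)=\{x\in X:y\in\partial_\Phi g(x)\}=\operatorname{argmin}_{x\in X}\{g(x)-\Phi(x,y)\}$. A point $x^\star$ with $F(x^\star)<\infty$ is $\Phi$-critical if $\partial_\Phi f(x^\star)\cap\partial_\Phi g(x^\star)\ne\emptyset$. $\Phi$-DCA: starting from $x^0\in\operatorname{dom}\partial_\Phi f=\{x:\partial_\Phi f(x)\neq\emptyset\}$, for $k\in\mathbb{N}_0$ choose $y^k\in\partial_\Phi f(x^k)$ and $x^{k+1}\in(\partial_\Phi g)^{-1}(y^k)$. For well-definedness it is assumed that $\emptyset\ne\operatorname{rge}(\partial_\Phi g)^{-1}\subseteq\operatorname{dom}\partial_\Phi f$ and $\emptyset\neq\operatorname{rge}\partial_\Phi f\subseteq\operatorname{dom}(\partial_\Phi g)^{-1}$ (dom = set of points with nonempty image, rge = union of all images). Gap functions: $\operatorname{gap}_g^\Phi(x,y)=g(x)+g^\Phi(y)-\Phi(x,y)$ and $\operatorname{gap}_f^\Phi(y,x)=f(x)+f^\Phi(y)-\Phi(x,y)$. *)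

theory Defs
  imports "HOL-Analysis.Analysis"
begin

text \<open>
  Functions \<open>X \<rightarrow> \<real> \<union> {\<plusminus>\<infinity>}\<close> are total functions into \<^typ>\<open>ereal\<close> whose values outside \<open>X\<close>
  are never used; likewise \<open>\<Phi>\<close> outside \<open>X \<times> Y\<close>.  Subtraction on \<^typ>\<open>ereal\<close> satisfies
  \<open>\<infinity> - \<infinity> = \<infinity>\<close>, which is the convention wanted for \<open>g - f\<close>.
\<close>

definition proper_on :: "'a set \<Rightarrow> ('a \<Rightarrow> ereal) \<Rightarrow> bool" where
  "proper_on X \<phi> \<longleftrightarrow> (\<forall>x\<in>X. \<phi> x \<noteq> -\<infinity>) \<and> (\<exists>x\<in>X. \<phi> x \<noteq> \<infinity>)"

text \<open>The filter \<^term>\<open>at x within X\<close> omits \<open>x\<close> itself; including it would give the same condition.\<close>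

definition lsc_on :: "'a::topological_space set \<Rightarrow> ('a \<Rightarrow> ereal) \<Rightarrow> bool" where
  "lsc_on X \<phi> \<longleftrightarrow> (\<forall>x\<in>X. \<phi> x \<le> Liminf (at x within X) \<phi>)"

text \<open>
  A family \<open>(y\<^sub>i, \<beta>\<^sub>i)\<close>, \<open>i \<in> I\<close>, enters the supremum only through its set \<open>S\<close> of values, so \<open>S\<close> serves
  as its own index set.  For \<open>S = {}\<close> the supremum is \<open>-\<infinity>\<close>.
\<close>

definition Phi_convex_on ::
    "'a set \<Rightarrow> 'b set \<Rightarrow> ('a \<Rightarrow> 'b \<Rightarrow> real) \<Rightarrow> ('a \<Rightarrow> ereal) \<Rightarrow> bool" where
  "Phi_convex_on X Y \<Phi> \<phi> \<longleftrightarrow>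
     (\<exists>S \<subseteq> Y \<times> (UNIV :: ereal set). \<forall>x\<in>X. \<phi> x = (SUP (y, \<beta>)\<in>S. ereal (\<Phi> x y) - \<beta>))"

definition Phi_conjugate ::
    "'a set \<Rightarrow> ('a \<Rightarrow> 'b \<Rightarrow> real) \<Rightarrow> ('a \<Rightarrow> ereal) \<Rightarrow> 'b \<Rightarrow> ereal" where
  "Phi_conjugate X \<Phi> \<phi> y = (SUP x\<in>X. ereal (\<Phi> x y) - \<phi> x)"

definition Phi_subdiff ::
    "'a set \<Rightarrow> 'b set \<Rightarrow> ('a \<Rightarrow> 'b \<Rightarrow> real) \<Rightarrow> ('a \<Rightarrow> ereal) \<Rightarrow> 'a \<Rightarrow> 'b set" where
  "Phi_subdiff X Y \<Phi> \<phi> x' =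
     {y \<in> Y. \<forall>x\<in>X. \<phi> x \<ge> \<phi> x' + ereal (\<Phi> x y) - ereal (\<Phi> x' y)}"

definition Phi_subdiff_inv ::
    "'a set \<Rightarrow> 'b set \<Rightarrow> ('a \<Rightarrow> 'b \<Rightarrow> real) \<Rightarrow> ('a \<Rightarrow> ereal) \<Rightarrow> 'b \<Rightarrow> 'a set" where
  "Phi_subdiff_inv X Y \<Phi> \<phi> y = {x \<in> X. y \<in> Phi_subdiff X Y \<Phi> \<phi> x}"

text \<open>Domain and range of a set-valued map \<open>M\<close> defined on \<open>A\<close>.\<close>

definition dom_on :: "'a set \<Rightarrow> ('a \<Rightarrow> 'b set) \<Rightarrow> 'a set" where
  "dom_on A M = {a \<in> A. M a \<noteq> {}}"

definition rge_on :: "'a set \<Rightarrow> ('a \<Rightarrow> 'b set) \<Rightarrow> 'b set" where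
  "rge_on A M = (\<Union>a\<in>A. M a)"

definition Phi_critical ::
    "'a set \<Rightarrow> 'b set \<Rightarrow> ('a \<Rightarrow> 'b \<Rightarrow> real) \<Rightarrow> ('a \<Rightarrow> ereal) \<Rightarrow> ('a \<Rightarrow> ereal) \<Rightarrow> 'a \<Rightarrow> bool" where
  "Phi_critical X Y \<Phi> g f x \<longleftrightarrow>
     x \<in> X \<and> g x - f x < \<infinity> \<and> Phi_subdiff X Y \<Phi> f x \<inter> Phi_subdiff X Y \<Phi> g x \<noteq> {}"

definition Phi_DCA ::
    "'a set \<Rightarrow> 'b set \<Rightarrow> ('a \<Rightarrow> 'b \<Rightarrow> real) \<Rightarrow> ('a \<Rightarrow> ereal) \<Rightarrow> ('a \<Rightarrow> ereal) \<Rightarrow>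
      (nat \<Rightarrow> 'a) \<Rightarrow> (nat \<Rightarrow> 'b) \<Rightarrow> bool" where
  "Phi_DCA X Y \<Phi> g f x y \<longleftrightarrow>
     x 0 \<in> dom_on X (Phi_subdiff X Y \<Phi> f) \<and>
     (\<forall>k. y k \<in> Phi_subdiff X Y \<Phi> f (x k) \<and> x (Suc k) \<in> Phi_subdiff_inv X Y \<Phi> g (y k))"

text \<open>
  Both gap functions are instances: \<open>gap\<^sub>g(x, y)\<close> is \<open>Phi_gap X \<Phi> g x y\<close> and \<open>gap\<^sub>f(y, x)\<close>, whose
  arguments are customarily swapped, is \<open>Phi_gap X \<Phi> f x y\<close>.
\<close>

definition Phi_gap ::
    "'a set \<Rightarrow> ('a \<Rightarrow> 'b \<Rightarrow> real) \<Rightarrow> ('a \<Rightarrow> ereal) \<Rightarrow> 'a \<Rightarrow> 'b \<Rightarrow> ereal" where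
  "Phi_gap X \<Phi> \<phi> x y = \<phi> x + Phi_conjugate X \<Phi> \<phi> y - ereal (\<Phi> x y)"

end

theory Submission
  imports Defs
begin

text \<open>
  Write \<open>F = g - f\<close>.  A subgradient attains the supremum in the conjugate (Fenchel--Young equality,
  \<open>Phi_conjugate_eq_if_subgradient\<close>), so \<open>y\<^sup>k \<in> \<partial>f(x\<^sup>k)\<close> and \<open>y\<^sup>k \<in> \<partial>g(x\<^sup>k\<^sup>+\<^sup>1)\<close> turn both gaps into
  differences of function values and of \<open>\<Phi>\<close>-values.  The \<open>\<Phi>\<close>-terms cancel in the sum, which gives
  \<open>gap\<^sub>g(x\<^sup>k, y\<^sup>k) + gap\<^sub>f(y\<^sup>k, x\<^sup>k\<^sup>+\<^sup>1) = F(x\<^sup>k) - F(x\<^sup>k\<^sup>+\<^sup>1)\<close>.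
  Both gaps are nonnegative, hence \<open>F(x\<^sup>k)\<close> decreases; as \<open>F\<close> is bounded below, the decrements and with
  them the gaps tend to \<open>0\<close>.  Only \<open>g(x\<^sup>0)\<close> may be infinite, so the identity is used from \<open>k = 1\<close> on.

  The claim on limit points is a closedness property: the gap of \<open>\<phi>\<close> at \<open>(u, v)\<close> measures by how
  much \<open>v\<close> fails to be a subgradient of \<open>\<phi>\<close> at \<open>u\<close>, and for lower semicontinuous \<open>\<phi>\<close> and continuous
  \<open>\<Phi>\<close> the subgradient inequality survives the passage to the limit along points whose gap vanishes
  (\<open>subgradient_of_limit\<close>).  It applies to \<open>g\<close> because \<open>gap\<^sub>g(x\<^sup>k, y\<^sup>k) \<rightarrow> 0\<close>, and to \<open>f\<close>
  because the gap of \<open>f\<close> at \<open>(x\<^sup>k, y\<^sup>k)\<close> is exactly \<open>0\<close> and \<open>f\<close>, a supremum of continuous functions, is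
  lower semicontinuous.
\<close>

lemma Phi_subdiffD:
  assumes "v \<in> Phi_subdiff X Y \<Phi> \<phi> u" and "w \<in> X"
  shows "\<phi> u + ereal (\<Phi> w v) - ereal (\<Phi> u v) \<le> \<phi> w"
  using assms by (auto simp: Phi_subdiff_def)

text \<open>If \<open>\<phi> u\<close> were \<open>\<infinity>\<close>, the subgradient inequality would force \<open>\<phi> = \<infinity>\<close> on all of \<open>X\<close>.\<close>

lemma finite_if_subgradient:
  assumes "proper_on X \<phi>" and "u \<in> X" and "v \<in> Phi_subdiff X Y \<Phi> \<phi> u"
  shows "\<bar>\<phi> u\<bar> \<noteq> \<infinity>"
proof -
  obtain w where "w \<in> X" "\<phi> w \<noteq> \<infinity>"
    using assms(1) by (auto simp: proper_on_def)
  with Phi_subdiffD[OF assms(3) \<open>w \<in> X\<close>] have "\<phi> u \<noteq> \<infinity>"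
    by auto
  moreover have "\<phi> u \<noteq> -\<infinity>"
    using assms(1,2) by (auto simp: proper_on_def)
  ultimately show ?thesis
    by auto
qed

lemma Phi_conjugate_eq_if_subgradient:
  assumes "proper_on X \<phi>" and "u \<in> X" and "v \<in> Phi_subdiff X Y \<Phi> \<phi> u"
  shows "Phi_conjugate X \<Phi> \<phi> v = ereal (\<Phi> u v) - \<phi> u"
  unfolding Phi_conjugate_def
proof (rule antisym)
  show "ereal (\<Phi> u v) - \<phi> u \<le> (SUP x\<in>X. ereal (\<Phi> x v) - \<phi> x)"
    using assms(2) by (rule SUP_upper)
  show "(SUP x\<in>X. ereal (\<Phi> x v) - \<phi> x) \<le> ereal (\<Phi> u v) - \<phi> u"
  proof (rule SUP_least)
    fix w assume "w \<in> X"
    moreover have "\<bar>\<phi> u\<bar> \<noteq> \<infinity>"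
      using assms by (rule finite_if_subgradient)
    ultimately show "ereal (\<Phi> w v) - \<phi> w \<le> ereal (\<Phi> u v) - \<phi> u"
      using Phi_subdiffD[OF assms(3), of w]
      by (cases "\<phi> u"; cases "\<phi> w") auto
  qed
qed

lemma Phi_gap_eq_if_subgradient:
  assumes "proper_on X \<phi>" and "u \<in> X" and "v \<in> Phi_subdiff X Y \<Phi> \<phi> u"
  shows "Phi_gap X \<Phi> \<phi> w v = \<phi> w + (ereal (\<Phi> u v) - \<phi> u) - ereal (\<Phi> w v)"
  by (simp add: Phi_gap_def Phi_conjugate_eq_if_subgradient[OF assms])

text \<open>
  The gap is the error term with which an arbitrary \<open>v\<close> satisfies the subgradient inequality at
  \<open>u\<close>.  Properness keeps \<open>\<phi>\<close> and its conjugate away from \<open>-\<infinity>\<close>, so no cancellation of infinities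
  spoils the inequality.
\<close>

lemma approx_subgradient_inequality:
  assumes "proper_on X \<phi>" and "u \<in> X" and "w \<in> X"
  shows "\<phi> u + ereal (\<Phi> w v - \<Phi> u v) \<le> \<phi> w + Phi_gap X \<Phi> \<phi> u v"
proof -
  obtain z where z: "z \<in> X" "\<phi> z \<noteq> \<infinity>" "\<phi> z \<noteq> -\<infinity>"
    using assms(1) by (auto simp: proper_on_def)
  have young: "ereal (\<Phi> s v) - \<phi> s \<le> Phi_conjugate X \<Phi> \<phi> v" if "s \<in> X" for s
    unfolding Phi_conjugate_def using that by (rule SUP_upper)
  have "Phi_conjugate X \<Phi> \<phi> v \<noteq> -\<infinity>"
    using young[OF z(1)] z(2,3) by (cases "\<phi> z") auto
  moreover have "\<phi> u \<noteq> -\<infinity>" "\<phi> w \<noteq> -\<infinity>"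
    using assms by (auto simp: proper_on_def)
  ultimately show ?thesis
    using young[OF assms(3)] unfolding Phi_gap_def
    by (cases "\<phi> u"; cases "\<phi> w"; cases "Phi_conjugate X \<Phi> \<phi> v") auto
qed

text \<open>
  The sequence may visit its limit, which the filter in \<^const>\<open>lsc_on\<close> leaves out; there the
  bound holds by assumption.
\<close>

lemma lsc_on_eventually_less:
  assumes "lsc_on X \<phi>" and "u \<in> X" and "\<And>n. s n \<in> X" and "s \<longlonglongrightarrow> u" and "c < \<phi> u"
  shows "eventually (\<lambda>n. c < \<phi> (s n)) sequentially"
proof -
  have "eventually (\<lambda>z. c < \<phi> z) (at u within X)"
    using assms(1,2,5) by (auto simp: lsc_on_def le_Liminf_iff)
  hence "eventually (\<lambda>z. z \<in> X \<longrightarrow> c < \<phi> z) (nhds u)"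
    using assms(5) by (auto simp: eventually_at_filter elim!: eventually_mono)
  from eventually_compose_filterlim[OF this assms(4)] show ?thesis
    using assms(3) by simp
qed

lemma Phi_convex_on_imp_lsc_on:
  fixes \<Phi> :: "'a::topological_space \<Rightarrow> 'b::topological_space \<Rightarrow> real"
  assumes "continuous_on (X \<times> Y) (\<lambda>(u, v). \<Phi> u v)" and "Phi_convex_on X Y \<Phi> \<phi>"
  shows "lsc_on X \<phi>"
  unfolding lsc_on_def le_Liminf_iff
proof (intro ballI allI impI)
  fix u c assume u: "u \<in> X" and c: "c < \<phi> u"
  obtain S where S: "S \<subseteq> Y \<times> UNIV"
    and \<phi>: "\<And>x. x \<in> X \<Longrightarrow> \<phi> x = (SUP (y, \<beta>)\<in>S. ereal (\<Phi> x y) - \<beta>)"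
    using assms(2) by (auto simp: Phi_convex_on_def)
  obtain y \<beta> where y\<beta>: "(y, \<beta>) \<in> S" "c < ereal (\<Phi> u y) - \<beta>"
    using c u by (auto simp: \<phi> less_SUP_iff)
  have "continuous_on X (\<lambda>x. (\<lambda>(u, v). \<Phi> u v) (x, y))"
    using S y\<beta>(1) by (intro continuous_on_compose2[OF assms(1)] continuous_intros) auto
  hence "((\<lambda>x. \<Phi> x y) \<longlongrightarrow> \<Phi> u y) (at u within X)"
    using u by (simp add: continuous_on)
  hence "((\<lambda>x. ereal (\<Phi> x y) - \<beta>) \<longlongrightarrow> ereal (\<Phi> u y) - \<beta>) (at u within X)"
    by (cases \<beta>) (auto intro!: tendsto_intros)
  hence "eventually (\<lambda>x. c < ereal (\<Phi> x y) - \<beta>) (at u within X)"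
    using y\<beta>(2) by (rule order_tendstoD)
  moreover have "eventually (\<lambda>x. x \<in> X) (at u within X)"
    by (simp add: eventually_at_filter)
  ultimately show "eventually (\<lambda>x. c < \<phi> x) (at u within X)"
  proof eventually_elim
    case (elim x)
    have "ereal (\<Phi> x y) - \<beta> \<le> \<phi> x"
      using y\<beta>(1) by (auto simp: \<phi>[OF elim(2)] intro!: SUP_upper2)
    with elim(1) show ?case
      by (rule less_le_trans)
  qed
qed

text \<open>
  Lower semicontinuity is just what allows the value \<open>\<phi> (s n)\<close> on the smaller side of the approximate
  subgradient inequality to be replaced by \<open>\<phi> u\<close> in the limit; the \<open>\<Phi>\<close>-terms converge by continuity.
\<close>

lemma subgradient_of_limit:
  fixes \<Phi> :: "'a::topological_space \<Rightarrow> 'b::topological_space \<Rightarrow> real"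
  assumes \<Phi>: "continuous_on (X \<times> Y) (\<lambda>(u, v). \<Phi> u v)"
    and \<phi>: "proper_on X \<phi>" "lsc_on X \<phi>"
    and s: "\<And>n. s n \<in> X" "s \<longlonglongrightarrow> u" "u \<in> X"
    and t: "\<And>n. t n \<in> Y" "t \<longlonglongrightarrow> v" "v \<in> Y"
    and gap: "(\<lambda>n. Phi_gap X \<Phi> \<phi> (s n) (t n)) \<longlonglongrightarrow> 0"
  shows "v \<in> Phi_subdiff X Y \<Phi> \<phi> u"
  unfolding Phi_subdiff_def
proof (intro CollectI conjI ballI)
  fix w assume w: "w \<in> X"
  have \<Phi>_lim: "(\<lambda>n. \<Phi> (p n) (t n)) \<longlonglongrightarrow> \<Phi> q v"
    if "\<And>n. p n \<in> X" "p \<longlonglongrightarrow> q" "q \<in> X" for p q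
    using continuous_on_tendsto_compose[OF \<Phi>, of "\<lambda>n. (p n, t n)" "(q, v)"] that t
    by (auto intro: tendsto_Pair)
  have lim_diff: "(\<lambda>n. \<Phi> w (t n) - \<Phi> (s n) (t n)) \<longlonglongrightarrow> \<Phi> w v - \<Phi> u v"
    using w s by (intro tendsto_diff \<Phi>_lim) auto
  have lim_right: "(\<lambda>n. \<phi> w + Phi_gap X \<Phi> \<phi> (s n) (t n)) \<longlonglongrightarrow> \<phi> w + 0"
    using gap by (intro tendsto_add_ereal_general) auto
  have "\<phi> u \<le> \<phi> w - ereal (\<Phi> w v - \<Phi> u v)"
  proof (rule dense_le)
    fix c assume c: "c < \<phi> u"
    have lim_left: "(\<lambda>n. c + ereal (\<Phi> w (t n) - \<Phi> (s n) (t n))) \<longlonglongrightarrow> c + ereal (\<Phi> w v - \<Phi> u v)"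
      using lim_diff by (intro tendsto_add_ereal_general) auto
    have "eventually (\<lambda>n. c + ereal (\<Phi> w (t n) - \<Phi> (s n) (t n))
        \<le> \<phi> w + Phi_gap X \<Phi> \<phi> (s n) (t n)) sequentially"
      using lsc_on_eventually_less[OF \<phi>(2) s(3,1,2) c]
    proof eventually_elim
      case (elim n)
      hence "c + ereal (\<Phi> w (t n) - \<Phi> (s n) (t n)) \<le> \<phi> (s n) + ereal (\<Phi> w (t n) - \<Phi> (s n) (t n))"
        by (intro add_right_mono) simp
      also have "\<dots> \<le> \<phi> w + Phi_gap X \<Phi> \<phi> (s n) (t n)"
        using \<phi>(1) s(1) w by (rule approx_subgradient_inequality)
      finally show ?case .
    qed
    from tendsto_le[OF sequentially_bot lim_right lim_left this]
    show "c \<le> \<phi> w - ereal (\<Phi> w v - \<Phi> u v)"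
      by (simp add: ereal_le_minus)
  qed
  thus "\<phi> u + ereal (\<Phi> w v) - ereal (\<Phi> u v) \<le> \<phi> w"
    by (cases "\<phi> u"; cases "\<phi> w") auto
qed fact

lemma nonneg_decrement_parts_tendsto_0:
  fixes h a b :: "nat \<Rightarrow> real"
  assumes "\<And>k. 0 \<le> a k" and "\<And>k. 0 \<le> b k" and "\<And>k. a k + b k = h k - h (Suc k)"
    and "\<And>k. m \<le> h k"
  shows "a \<longlonglongrightarrow> 0" and "b \<longlonglongrightarrow> 0"
proof -
  have le: "a k \<le> h k - h (Suc k)" "b k \<le> h k - h (Suc k)" for k
    using assms(1-3)[of k] by linarith+
  have "decseq h"
    using assms(1) le(1) by (intro decseq_SucI) (metis diff_ge_0_iff_ge order_trans)
  then obtain l where "h \<longlonglongrightarrow> l"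
    using assms(4) by (metis decseq_convergent)
  hence "(\<lambda>k. h k - h (Suc k)) \<longlonglongrightarrow> l - l"
    by (intro tendsto_diff LIMSEQ_Suc)
  hence lim: "(\<lambda>k. h k - h (Suc k)) \<longlonglongrightarrow> 0"
    by simp
  show "a \<longlonglongrightarrow> 0"
    using assms(1) le(1) by (intro tendsto_sandwich[OF _ _ tendsto_const lim]) auto
  show "b \<longlonglongrightarrow> 0"
    using assms(2) le(2) by (intro tendsto_sandwich[OF _ _ tendsto_const lim]) auto
qed

lemma Phi_DCA_iterates:
  assumes "Phi_DCA X Y \<Phi> g f x y"
  shows "x k \<in> X" and "y k \<in> Y"
    and "y k \<in> Phi_subdiff X Y \<Phi> f (x k)" and "y k \<in> Phi_subdiff X Y \<Phi> g (x (Suc k))"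
  using assms
  by (cases k; auto simp: Phi_DCA_def dom_on_def Phi_subdiff_inv_def Phi_subdiff_def)+

text \<open>
  The telescoping of \<open>F\<close> along the iterates.  It is carried out in the reals, which is possible
  from \<open>x\<^sup>1\<close> on: those iterates carry a subgradient of \<open>f\<close> and one of \<open>g\<close>, so both functions are
  finite there.
\<close>

lemma Phi_DCA_gaps_tendsto_0:
  assumes f: "proper_on X f" and g: "proper_on X g"
    and bdd: "-\<infinity> < (INF u\<in>X. g u - f u)"
    and dca: "Phi_DCA X Y \<Phi> g f x y"
  shows "(\<lambda>k. Phi_gap X \<Phi> g (x k) (y k)) \<longlonglongrightarrow> 0"
    and "(\<lambda>k. Phi_gap X \<Phi> f (x (Suc k)) (y k)) \<longlonglongrightarrow> 0"
proof -
  note it = Phi_DCA_iterates[OF dca]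
  define fr where "fr k = real_of_ereal (f (x (Suc k)))" for k
  define gr where "gr k = real_of_ereal (g (x (Suc k)))" for k
  have fr: "f (x (Suc k)) = ereal (fr k)" for k
    unfolding fr_def using finite_if_subgradient[OF f it(1,3)] by (simp add: ereal_real)
  have gr: "g (x (Suc k)) = ereal (gr k)" for k
    unfolding gr_def using finite_if_subgradient[OF g it(1,4)] by (simp add: ereal_real)
  define d where "d k = \<Phi> (x (Suc (Suc k))) (y (Suc k)) - \<Phi> (x (Suc k)) (y (Suc k))" for k
  define a where "a k = gr k - gr (Suc k) + d k" for k
  define b where "b k = fr (Suc k) - fr k - d k" for k
  have gap_g: "Phi_gap X \<Phi> g (x (Suc k)) (y (Suc k)) = ereal (a k)" for k
    by (simp add: Phi_gap_eq_if_subgradient[OF g it(1,4)] gr a_def d_def)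
  have gap_f: "Phi_gap X \<Phi> f (x (Suc (Suc k))) (y (Suc k)) = ereal (b k)" for k
    by (simp add: Phi_gap_eq_if_subgradient[OF f it(1,3)] fr b_def d_def)
  have a: "0 \<le> a k" for k
    using Phi_subdiffD[OF it(4)[of "Suc k"] it(1)[of "Suc k"]] by (simp add: gr a_def d_def)
  have b: "0 \<le> b k" for k
    using Phi_subdiffD[OF it(3)[of "Suc k"] it(1)[of "Suc (Suc k)"]] by (simp add: fr b_def d_def)
  have sum: "a k + b k = (gr k - fr k) - (gr (Suc k) - fr (Suc k))" for k
    by (simp add: a_def b_def)
  have lower: "(INF u\<in>X. g u - f u) \<le> ereal (gr k - fr k)" for k
    using INF_lower[OF it(1)[of "Suc k"], of "\<lambda>u. g u - f u"] by (simp add: fr gr)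
  obtain m where "(INF u\<in>X. g u - f u) = ereal m"
    using bdd lower[of 0] by (cases "INF u\<in>X. g u - f u") auto
  hence m: "m \<le> gr k - fr k" for k
    using lower[of k] by simp
  note lim = nonneg_decrement_parts_tendsto_0[of a b "\<lambda>k. gr k - fr k", OF a b sum m]
  have "(\<lambda>k. Phi_gap X \<Phi> g (x (Suc k)) (y (Suc k))) \<longlonglongrightarrow> 0"
    using lim(1) by (simp add: gap_g zero_ereal_def)
  thus "(\<lambda>k. Phi_gap X \<Phi> g (x k) (y k)) \<longlonglongrightarrow> 0"
    by (rule LIMSEQ_imp_Suc)
  have "(\<lambda>k. Phi_gap X \<Phi> f (x (Suc (Suc k))) (y (Suc k))) \<longlonglongrightarrow> 0"
    using lim(2) by (simp add: gap_f zero_ereal_def)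
  thus "(\<lambda>k. Phi_gap X \<Phi> f (x (Suc k)) (y k)) \<longlonglongrightarrow> 0"
    by (rule LIMSEQ_imp_Suc)
qed

theorem theorem5p4:
  fixes X :: "(real ^ 'n) set" and Y :: "(real ^ 'm) set"
    and \<Phi> :: "real ^ 'n \<Rightarrow> real ^ 'm \<Rightarrow> real"
    and f g :: "real ^ 'n \<Rightarrow> ereal"
    and x :: "nat \<Rightarrow> real ^ 'n" and y :: "nat \<Rightarrow> real ^ 'm"
  assumes "X \<noteq> {}" and "Y \<noteq> {}"
    and "continuous_on (X \<times> Y) (\<lambda>(u, v). \<Phi> u v)"
    and "proper_on X f" and "Phi_convex_on X Y \<Phi> f"
    and "proper_on X g" and "lsc_on X g"
    and "\<exists>v\<in>Y. \<exists>\<beta>::real. \<forall>u\<in>X. g u \<ge> ereal (\<Phi> u v - \<beta>)"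
    and "-\<infinity> < (INF u\<in>X. g u - f u)" and "(INF u\<in>X. g u - f u) < \<infinity>"
    and "rge_on Y (Phi_subdiff_inv X Y \<Phi> g) \<noteq> {}"
    and "rge_on Y (Phi_subdiff_inv X Y \<Phi> g) \<subseteq> dom_on X (Phi_subdiff X Y \<Phi> f)"
    and "rge_on X (Phi_subdiff X Y \<Phi> f) \<noteq> {}"
    and "rge_on X (Phi_subdiff X Y \<Phi> f) \<subseteq> dom_on Y (Phi_subdiff_inv X Y \<Phi> g)"
    and "Phi_DCA X Y \<Phi> g f x y"
  shows "(\<lambda>k. Phi_gap X \<Phi> g (x k) (y k)) \<longlonglongrightarrow> 0 \<and>
    (\<lambda>k. Phi_gap X \<Phi> f (x (Suc k)) (y k)) \<longlonglongrightarrow> 0 \<and>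
    (\<forall>xs\<in>X. \<forall>ys\<in>Y.
      (\<exists>r. strict_mono r \<and> (\<lambda>k. (x (r k), y (r k))) \<longlonglongrightarrow> (xs, ys)) \<longrightarrow>
      ys \<in> Phi_subdiff X Y \<Phi> f xs \<inter> Phi_subdiff X Y \<Phi> g xs \<and> Phi_critical X Y \<Phi> g f xs)"
proof (intro conjI ballI impI)
  note it = Phi_DCA_iterates[OF assms(15)]
  note lim_gaps = Phi_DCA_gaps_tendsto_0[OF assms(4,6,9,15)]
  show "(\<lambda>k. Phi_gap X \<Phi> g (x k) (y k)) \<longlonglongrightarrow> 0"
    by (fact lim_gaps(1))
  show "(\<lambda>k. Phi_gap X \<Phi> f (x (Suc k)) (y k)) \<longlonglongrightarrow> 0"
    by (fact lim_gaps(2))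
  fix xs ys
  assume xs: "xs \<in> X" and ys: "ys \<in> Y"
    and "\<exists>r. strict_mono r \<and> (\<lambda>k. (x (r k), y (r k))) \<longlonglongrightarrow> (xs, ys)"
  then obtain r where r: "strict_mono r" and lim: "(\<lambda>k. (x (r k), y (r k))) \<longlonglongrightarrow> (xs, ys)"
    by blast
  have lim_x: "(\<lambda>k. x (r k)) \<longlonglongrightarrow> xs" and lim_y: "(\<lambda>k. y (r k)) \<longlonglongrightarrow> ys"
    using tendsto_fst[OF lim] tendsto_snd[OF lim] by simp_all
  note limit_rule = subgradient_of_limit[OF assms(3) _ _ it(1) lim_x xs it(2) lim_y ys]
  have gap_g: "(\<lambda>k. Phi_gap X \<Phi> g (x (r k)) (y (r k))) \<longlonglongrightarrow> 0"
    using LIMSEQ_subseq_LIMSEQ[OF lim_gaps(1) r] by (simp add: o_def)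
  have sub_g: "ys \<in> Phi_subdiff X Y \<Phi> g xs"
    by (rule limit_rule[OF assms(6,7) gap_g])
  have "Phi_gap X \<Phi> f (x k) (y k) = 0" for k
    using finite_if_subgradient[OF assms(4) it(1,3), of k]
    by (cases "f (x k)") (simp_all add: Phi_gap_eq_if_subgradient[OF assms(4) it(1,3)])
  hence gap_f: "(\<lambda>k. Phi_gap X \<Phi> f (x (r k)) (y (r k))) \<longlonglongrightarrow> 0"
    by simp
  have sub_f: "ys \<in> Phi_subdiff X Y \<Phi> f xs"
    by (rule limit_rule[OF assms(4) Phi_convex_on_imp_lsc_on[OF assms(3,5)] gap_f])
  show both: "ys \<in> Phi_subdiff X Y \<Phi> f xs \<inter> Phi_subdiff X Y \<Phi> g xs"
    using sub_f sub_g by simp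
  have "g xs - f xs < \<infinity>"
    using finite_if_subgradient[OF assms(6) xs sub_g] finite_if_subgradient[OF assms(4) xs sub_f]
    by (cases "g xs"; cases "f xs") auto
  with xs both show "Phi_critical X Y \<Phi> g f xs"
    by (auto simp: Phi_critical_def)
qed

end
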